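(* In an augmented virtual double category let $f\colon A\to C$ be a vertical morphism, $J\colon A\nrightarrow C$ a horizontal morphism, $\phi\colon(A)\Rightarrow J$ a cell with vertical source $\mathrm{id}_A$ and vertical target $f$, and $\psi\colon J\Rightarrow(C)$ a cell with vertical source $f$ and vertical target $\mathrm{id}_C$, such that $\mathrm{id}_f=\psi\circ\phi$. The following conditions are equivalent: (i) $\psi$ is cartesian; (ii) $\phi\odot\psi=\mathrm{id}_J$; (iii) $\phi$ is weakly cocartesian.
   Context: **Augmented virtual double categories.** An augmented virtual double category $\mathcal K$ consists of: a class of objects; a category $\mathcal K_{\mathrm v}$ with these objects, whose morphisms $f\colon A\to C$ are called vertical; a directed graph $\mathcal K_{\mathrm h}$ with these objects as vertices, whose edges $J\colon A\nrightarrow B$ are called horizontal morphisms; and a class of cells. Each cell $\phi$ has a horizontal source, which is a (possibly empty) path $\underline J=(J_1,\dots,J_n)\colon A_0\nrightarrow A_n$ of horizontal morphisms; a horizontal target, which is a path $\underline K\colon C\nrightarrow D$ of length $|\underline K|\le 1$; a vertical source $f\colon A_0\to C$; and a vertical target $g\colon A_n\to D$. We write $\phi\colon\underline J\Rightarrow\underline K$. The empty path at $A$ is written $(A)$ (so $\underline K=(C)$ forces $C=D$), and $\frown$ denotes concatenation of paths. For each $n\ge 1$, each path of cells $\phi_i\colon\underline J_i\Rightarrow\underline K_i$ ($1\le i\le n$) with vertical source $f_{i-1}$ and vertical target $f_i$, and each cell $\psi\colon\underline K_1\frown\dots\frown\underline K_n\Rightarrow\underline L$ with vertical source $h$ and target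 $k$, there is a vertical composite $\psi\circ(\phi_1,\dots,\phi_n)\colon\underline J_1\frown\dots\frown\underline J_n\Rightarrow\underline L$ with vertical source $h\circ f_0$ and target $k\circ f_n$. There are horizontal identity cells $\mathrm{id}_J\colon J\Rightarrow J$ (with identities as vertical source and target) and vertical identity cells $\mathrm{id}_f\colon (A)\Rightarrow(C)$ for $f\colon A\to C$ (with vertical source and target $f$), with $\mathrm{id}_h\circ(\mathrm{id}_f)=\mathrm{id}_{h\circ f}$; write $\mathrm{id}_A:=\mathrm{id}_{\mathrm{id}_A}$. Axioms, whenever they make sense (for associativity: whenever both sides make sense): $\chi\circ(\psi_1\circ(\phi_{11},\dots,\phi_{1m_1}),\dots,\psi_n\circ(\phi_{n1},\dots,\phi_{nm_n}))=(\chi\circ(\psi_1,\dots,\psi_n))\circ(\phi_{11},\dots,\phi_{nm_n})$; $\mathrm{id}_C\circ(\phi)=\phi$; $\mathrm{id}_K\circ(\phi)=\phi$; $\phi\circ(\mathrm{id}_A)=\phi$; $\phi\circ(\mathrm{id}_{J_1},\dots,\mathrm{id}_{J_n})=\phi$; and $\psi\circ(\phi_1,\dots,\phi_i,\mathrm{id}_{f_i},\phi_{i+1},\dots,\phi_n)=\psi\circ(\phi_1,\dots,\phi_n)$ for $0\le i\le n$. Horizontal composition of cells: if $\phi\colon\underline J\Rightarrow\underline K$ and $\psi\colon\underline H\Rightarrow\underline L$ are such that the vertical target of $\phi$ is the vertical source of $\psi$ and $|\underline K|+|\underline L|\le1$, then $\phi\odot\psi:=\mathrm{id}_{\underline K\frown\underline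 L}\circ(\phi,\psi)\colon\underline J\frown\underline H\Rightarrow\underline K\frown\underline L$, where $\mathrm{id}_{\underline K\frown\underline L}$ is the identity cell of the single horizontal morphism in $\underline K\frown\underline L$, or $\mathrm{id}_C$ if $\underline K\frown\underline L=(C)$. **Cartesian and weakly cocartesian cells.** A cell $\psi\colon\underline J\Rightarrow\underline K$ with $|\underline J|\le1$, $\underline J\colon A\nrightarrow B$, vertical source $f\colon A\to C$ and target $g\colon B\to D$, is cartesian if every cell $\chi\colon\underline H\Rightarrow\underline K$, with $\underline H\colon X_0\nrightarrow X_n$ and with vertical source $f\circ h$ and target $g\circ k$ (for any $h\colon X_0\to A$, $k\colon X_n\to B$), factors as $\chi=\psi\circ\phi$ for a unique $\phi\colon\underline H\Rightarrow\underline J$ with vertical source $h$ and target $k$. A cell $\phi\colon\underline H\Rightarrow J$ with $J\colon A\nrightarrow B$ a single horizontal morphism, vertical source $h\colon X_0\to A$ and target $k\colon X_n\to B$, is weakly cocartesian if every cell $\chi\colon\underline H\Rightarrow\underline K$ with vertical source $f\circ h$ and target $g\circ k$ (for any $f\colon A\to C$, $g\colon B\to D$ and $\underline K\colon C\nrightarrow D$ of length $\le1$) factors as $\chi=\psi\circ\phi$ for a unique $\psi\colon J\Rightarrow\underline K$ with vertical source $f$ and target $g$. *)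

theory Defs
  imports Main
begin

text \<open>A path of horizontal morphisms is given by its starting object and its list of edges, so that
  there is an empty path \<open>(A, [])\<close> at each object \<open>A\<close>.\<close>

type_synonym ('o, 'h) path = "'o \<times> 'h list"

record ('o, 'v, 'h, 'c) avdc =
  Obj :: "'o set"
  Ver :: "'v set"
  Hor :: "'h set"
  Cell :: "'c set"
  vdom :: "'v \<Rightarrow> 'o"
  vcod :: "'v \<Rightarrow> 'o"
  vid :: "'o \<Rightarrow> 'v"
  vcomp :: "'v \<Rightarrow> 'v \<Rightarrow> 'v"  \<comment> \<open>\<open>vcomp \<K> g f\<close> is \<open>g\<close> after \<open>f\<close>\<close>
  hdom :: "'h \<Rightarrow> 'o"
  hcod :: "'h \<Rightarrow> 'o"
  hsrc :: "'c \<Rightarrow> ('o, 'h) path"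
  htgt :: "'c \<Rightarrow> ('o, 'h) path"
  vsrc :: "'c \<Rightarrow> 'v"
  vtgt :: "'c \<Rightarrow> 'v"
  ccomp :: "'c \<Rightarrow> 'c list \<Rightarrow> 'c"  \<comment> \<open>the vertical composite \<open>\<psi> \<circ> (\<phi>\<^sub>1, \<dots>, \<phi>\<^sub>n)\<close>\<close>
  idh :: "'h \<Rightarrow> 'c"
  idv :: "'v \<Rightarrow> 'c"

definition vert :: "('o, 'v, 'h, 'c) avdc \<Rightarrow> 'v \<Rightarrow> 'o \<Rightarrow> 'o \<Rightarrow> bool" where
  "vert \<K> f A C \<longleftrightarrow> f \<in> Ver \<K> \<and> vdom \<K> f = A \<and> vcod \<K> f = C"

definition horiz :: "('o, 'v, 'h, 'c) avdc \<Rightarrow> 'h \<Rightarrow> 'o \<Rightarrow> 'o \<Rightarrow> bool" where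
  "horiz \<K> J A B \<longleftrightarrow> J \<in> Hor \<K> \<and> hdom \<K> J = A \<and> hcod \<K> J = B"

fun walk :: "('o, 'v, 'h, 'c) avdc \<Rightarrow> 'o \<Rightarrow> 'h list \<Rightarrow> 'o \<Rightarrow> bool" where
  "walk \<K> A [] B \<longleftrightarrow> A \<in> Obj \<K> \<and> A = B"
| "walk \<K> A (J # Js) B \<longleftrightarrow> J \<in> Hor \<K> \<and> hdom \<K> J = A \<and> walk \<K> (hcod \<K> J) Js B"

definition hpath :: "('o, 'v, 'h, 'c) avdc \<Rightarrow> ('o, 'h) path \<Rightarrow> 'o \<Rightarrow> 'o \<Rightarrow> bool" where
  "hpath \<K> p A B \<longleftrightarrow> fst p = A \<and> walk \<K> A (snd p) B"

abbreviation plength :: "('o, 'h) path \<Rightarrow> nat" where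
  "plength p \<equiv> length (snd p)"

text \<open>Concatenation of a nonempty list of paths, meaningful if consecutive endpoints match.\<close>

definition pconcat :: "('o, 'h) path list \<Rightarrow> ('o, 'h) path" where
  "pconcat ps = (fst (hd ps), concat (map snd ps))"

definition cell ::
  "('o, 'v, 'h, 'c) avdc \<Rightarrow> 'c \<Rightarrow> ('o, 'h) path \<Rightarrow> ('o, 'h) path \<Rightarrow> 'v \<Rightarrow> 'v \<Rightarrow> bool" where
  "cell \<K> \<phi> p q f g \<longleftrightarrow>
     \<phi> \<in> Cell \<K> \<and> hsrc \<K> \<phi> = p \<and> htgt \<K> \<phi> = q \<and> vsrc \<K> \<phi> = f \<and> vtgt \<K> \<phi> = g"

text \<open>The composite of \<open>\<psi>\<close> with \<open>\<phi>s\<close> makes sense. In the axiom on inserting vertical identity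
  cells below, composability forces \<open>f\<close> to be the vertical morphism shared by the adjacent cells.\<close>

definition composable :: "('o, 'v, 'h, 'c) avdc \<Rightarrow> 'c \<Rightarrow> 'c list \<Rightarrow> bool" where
  "composable \<K> \<psi> \<phi>s \<longleftrightarrow>
     \<psi> \<in> Cell \<K> \<and> \<phi>s \<noteq> [] \<and> set \<phi>s \<subseteq> Cell \<K> \<and>
     successively (\<lambda>\<phi> \<phi>'. vtgt \<K> \<phi> = vsrc \<K> \<phi>') \<phi>s \<and>
     hsrc \<K> \<psi> = pconcat (map (htgt \<K>) \<phi>s)"

locale augmented_virtual_double_category =
  fixes \<K> :: "('o, 'v, 'h, 'c) avdc"
  assumes vdom_Obj: "f \<in> Ver \<K> \<Longrightarrow> vdom \<K> f \<in> Obj \<K>"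
    and vcod_Obj: "f \<in> Ver \<K> \<Longrightarrow> vcod \<K> f \<in> Obj \<K>"
    and vert_vid: "A \<in> Obj \<K> \<Longrightarrow> vert \<K> (vid \<K> A) A A"
    and vert_vcomp: "vert \<K> f A B \<Longrightarrow> vert \<K> g B C \<Longrightarrow> vert \<K> (vcomp \<K> g f) A C"
    and vcomp_assoc: "vert \<K> f A B \<Longrightarrow> vert \<K> g B C \<Longrightarrow> vert \<K> h C D \<Longrightarrow>
          vcomp \<K> h (vcomp \<K> g f) = vcomp \<K> (vcomp \<K> h g) f"
    and vcomp_vid_left: "vert \<K> f A B \<Longrightarrow> vcomp \<K> (vid \<K> B) f = f"
    and vcomp_vid_right: "vert \<K> f A B \<Longrightarrow> vcomp \<K> f (vid \<K> A) = f"
    and hdom_Obj: "J \<in> Hor \<K> \<Longrightarrow> hdom \<K> J \<in> Obj \<K>"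
    and hcod_Obj: "J \<in> Hor \<K> \<Longrightarrow> hcod \<K> J \<in> Obj \<K>"
    and cell_boundary: "cell \<K> \<phi> p q f g \<Longrightarrow>
          \<exists>A B C D. hpath \<K> p A B \<and> hpath \<K> q C D \<and> plength q \<le> 1 \<and>
                    vert \<K> f A C \<and> vert \<K> g B D"
    and cell_ccomp: "composable \<K> \<psi> \<phi>s \<Longrightarrow>
          cell \<K> (ccomp \<K> \<psi> \<phi>s) (pconcat (map (hsrc \<K>) \<phi>s)) (htgt \<K> \<psi>)
            (vcomp \<K> (vsrc \<K> \<psi>) (vsrc \<K> (hd \<phi>s)))
            (vcomp \<K> (vtgt \<K> \<psi>) (vtgt \<K> (last \<phi>s)))"
    and cell_idh: "horiz \<K> J A B \<Longrightarrow> cell \<K> (idh \<K> J) (A, [J]) (A, [J]) (vid \<K> A) (vid \<K> B)"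
    and cell_idv: "vert \<K> f A C \<Longrightarrow> cell \<K> (idv \<K> f) (A, []) (C, []) f f"
    and idv_vcomp: "vert \<K> f A B \<Longrightarrow> vert \<K> h B C \<Longrightarrow>
          ccomp \<K> (idv \<K> h) [idv \<K> f] = idv \<K> (vcomp \<K> h f)"
    and ccomp_assoc: "list_all2 (composable \<K>) \<psi>s \<phi>ss \<Longrightarrow>
          composable \<K> \<chi> (map2 (ccomp \<K>) \<psi>s \<phi>ss) \<Longrightarrow>
          composable \<K> \<chi> \<psi>s \<Longrightarrow>
          composable \<K> (ccomp \<K> \<chi> \<psi>s) (concat \<phi>ss) \<Longrightarrow>
          ccomp \<K> \<chi> (map2 (ccomp \<K>) \<psi>s \<phi>ss) = ccomp \<K> (ccomp \<K> \<chi> \<psi>s) (concat \<phi>ss)"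
    and idv_ccomp: "C \<in> Obj \<K> \<Longrightarrow> composable \<K> (idv \<K> (vid \<K> C)) [\<phi>] \<Longrightarrow>
          ccomp \<K> (idv \<K> (vid \<K> C)) [\<phi>] = \<phi>"
    and idh_ccomp: "J \<in> Hor \<K> \<Longrightarrow> composable \<K> (idh \<K> J) [\<phi>] \<Longrightarrow>
          ccomp \<K> (idh \<K> J) [\<phi>] = \<phi>"
    and ccomp_idv: "A \<in> Obj \<K> \<Longrightarrow> composable \<K> \<phi> [idv \<K> (vid \<K> A)] \<Longrightarrow>
          ccomp \<K> \<phi> [idv \<K> (vid \<K> A)] = \<phi>"
    and ccomp_idh: "set Js \<subseteq> Hor \<K> \<Longrightarrow> composable \<K> \<phi> (map (idh \<K>) Js) \<Longrightarrow>
          ccomp \<K> \<phi> (map (idh \<K>) Js) = \<phi>"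
    and ccomp_insert_idv: "f \<in> Ver \<K> \<Longrightarrow> composable \<K> \<psi> (\<phi>s @ idv \<K> f # \<phi>s') \<Longrightarrow>
          composable \<K> \<psi> (\<phi>s @ \<phi>s') \<Longrightarrow>
          ccomp \<K> \<psi> (\<phi>s @ idv \<K> f # \<phi>s') = ccomp \<K> \<psi> (\<phi>s @ \<phi>s')"

text \<open>The identity cell of a path of length at most one.\<close>

fun idp :: "('o, 'v, 'h, 'c) avdc \<Rightarrow> ('o, 'h) path \<Rightarrow> 'c" where
  "idp \<K> (A, []) = idv \<K> (vid \<K> A)"
| "idp \<K> (A, [J]) = idh \<K> J"
| "idp \<K> (A, _ # _ # _) = undefined"

text \<open>Meaningful only if \<open>vtgt \<K> \<phi> = vsrc \<K> \<psi>\<close> and the horizontal targets of \<open>\<phi>\<close> and \<open>\<psi>\<close>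
  have total length at most one.\<close>

definition hcomp :: "('o, 'v, 'h, 'c) avdc \<Rightarrow> 'c \<Rightarrow> 'c \<Rightarrow> 'c" where
  "hcomp \<K> \<phi> \<psi> = ccomp \<K> (idp \<K> (pconcat [htgt \<K> \<phi>, htgt \<K> \<psi>])) [\<phi>, \<psi>]"

definition cartesian :: "('o, 'v, 'h, 'c) avdc \<Rightarrow> 'c \<Rightarrow> bool" where
  "cartesian \<K> \<psi> \<longleftrightarrow> \<psi> \<in> Cell \<K> \<and> plength (hsrc \<K> \<psi>) \<le> 1 \<and>
     (\<forall>\<chi> H X Y h k.
        hpath \<K> H X Y \<longrightarrow>
        vert \<K> h X (vdom \<K> (vsrc \<K> \<psi>)) \<longrightarrow>
        vert \<K> k Y (vdom \<K> (vtgt \<K> \<psi>)) \<longrightarrow>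
        cell \<K> \<chi> H (htgt \<K> \<psi>) (vcomp \<K> (vsrc \<K> \<psi>) h) (vcomp \<K> (vtgt \<K> \<psi>) k) \<longrightarrow>
        (\<exists>!\<phi>. cell \<K> \<phi> H (hsrc \<K> \<psi>) h k \<and> \<chi> = ccomp \<K> \<psi> [\<phi>]))"

definition weakly_cocartesian :: "('o, 'v, 'h, 'c) avdc \<Rightarrow> 'c \<Rightarrow> bool" where
  "weakly_cocartesian \<K> \<phi> \<longleftrightarrow> \<phi> \<in> Cell \<K> \<and> plength (htgt \<K> \<phi>) = 1 \<and>
     (\<forall>\<chi> L C D f g.
        hpath \<K> L C D \<longrightarrow> plength L \<le> 1 \<longrightarrow>
        vert \<K> f (vcod \<K> (vsrc \<K> \<phi>)) C \<longrightarrow>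
        vert \<K> g (vcod \<K> (vtgt \<K> \<phi>)) D \<longrightarrow>
        cell \<K> \<chi> (hsrc \<K> \<phi>) L (vcomp \<K> f (vsrc \<K> \<phi>)) (vcomp \<K> g (vtgt \<K> \<phi>)) \<longrightarrow>
        (\<exists>!\<psi>. cell \<K> \<psi> (htgt \<K> \<phi>) L f g \<and> \<chi> = ccomp \<K> \<psi> [\<phi>]))"

end

theory Submission
  imports Defs
begin

text \<open>Both directions rest on explicit formulas for the factorisations. A cell \<open>\<chi>\<close> factors through
  \<open>\<psi>\<close> by means of \<open>id\<^sub>J \<circ> (\<phi> \<circ> id\<^sub>h, \<chi>)\<close>, and a cell \<open>\<chi>\<close> factors through \<open>\<phi>\<close> by means of
  \<open>id\<^sub>L \<circ> (\<chi>, id\<^sub>g \<circ> \<psi>)\<close>; associativity, the unit axioms and \<open>\<psi> \<circ> \<phi> = id\<^sub>f\<close> show that these are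
  factorisations, and \<open>\<phi> \<odot> \<psi> = id\<^sub>J\<close> makes them unique. Conversely \<open>\<psi> \<circ> (\<phi> \<odot> \<psi>) = \<psi>\<close> and
  \<open>(\<phi> \<odot> \<psi>) \<circ> \<phi> = \<phi>\<close> always hold, so either uniqueness property forces \<open>\<phi> \<odot> \<psi> = id\<^sub>J\<close>.\<close>

lemma pconcat_single [simp]: "pconcat [p] = p"
  by (simp add: pconcat_def)

text \<open>\<open>pconcat\<close> reads its starting object off the first path, which explains the
  side condition on \<open>A\<close>.\<close>

lemma pconcat_empty_left: "fst p = A \<Longrightarrow> pconcat [(A, []), p] = p"
  by (auto simp: pconcat_def)

lemma pconcat_empty_right [simp]: "pconcat [p, (B, [])] = p"
  by (simp add: pconcat_def)

context augmented_virtual_double_category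
begin

section \<open>Composition and associativity for one or two cells\<close>

lemma composable_single:
  assumes "cell \<K> \<psi> K L h k" and "cell \<K> \<phi> J K f g"
  shows "composable \<K> \<psi> [\<phi>]"
  using assms by (simp add: composable_def cell_def)

lemma composable_pair:
  assumes "cell \<K> \<psi> (pconcat [K1, K2]) L h k"
    and "cell \<K> \<phi>1 J1 K1 f0 f1" and "cell \<K> \<phi>2 J2 K2 f1 f2"
  shows "composable \<K> \<psi> [\<phi>1, \<phi>2]"
  using assms by (simp add: composable_def cell_def)

lemma cell_ccomp_single:
  assumes "cell \<K> \<psi> K L h k" and "cell \<K> \<phi> J K f g"
  shows "cell \<K> (ccomp \<K> \<psi> [\<phi>]) J L (vcomp \<K> h f) (vcomp \<K> k g)"
  using cell_ccomp[OF composable_single[OF assms]] assms by (simp add: cell_def)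

lemma cell_ccomp_pair:
  assumes "cell \<K> \<psi> (pconcat [K1, K2]) L h k"
    and "cell \<K> \<phi>1 J1 K1 f0 f1" and "cell \<K> \<phi>2 J2 K2 f1 f2"
  shows "cell \<K> (ccomp \<K> \<psi> [\<phi>1, \<phi>2]) (pconcat [J1, J2]) L (vcomp \<K> h f0) (vcomp \<K> k f2)"
  using cell_ccomp[OF composable_pair[OF assms]] assms by (simp add: cell_def)

lemma ccomp_assoc_single:
  assumes "cell \<K> \<chi> L M p q" and "cell \<K> \<psi> K L h k" and "cell \<K> \<phi> J K f g"
  shows "ccomp \<K> \<chi> [ccomp \<K> \<psi> [\<phi>]] = ccomp \<K> (ccomp \<K> \<chi> [\<psi>]) [\<phi>]"
  using ccomp_assoc[of "[\<psi>]" "[[\<phi>]]" \<chi>] composable_single[OF assms(2,3)]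
    composable_single[OF assms(1,2)]
    composable_single[OF assms(1) cell_ccomp_single[OF assms(2,3)]]
    composable_single[OF cell_ccomp_single[OF assms(1,2)] assms(3)]
  by simp

lemma ccomp_assoc_single_pair:
  assumes "cell \<K> \<chi> L M p q" and "cell \<K> \<psi> (pconcat [K1, K2]) L h k"
    and "cell \<K> \<phi>1 J1 K1 f0 f1" and "cell \<K> \<phi>2 J2 K2 f1 f2"
  shows "ccomp \<K> \<chi> [ccomp \<K> \<psi> [\<phi>1, \<phi>2]] = ccomp \<K> (ccomp \<K> \<chi> [\<psi>]) [\<phi>1, \<phi>2]"
  using ccomp_assoc[of "[\<psi>]" "[[\<phi>1, \<phi>2]]" \<chi>] composable_pair[OF assms(2-4)]
    composable_single[OF assms(1,2)]
    composable_single[OF assms(1) cell_ccomp_pair[OF assms(2-4)]]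
    composable_pair[OF cell_ccomp_single[OF assms(1,2)] assms(3,4)]
  by simp

text \<open>Associativity for two one-element blocks; with padding by identity cells it carries
  every later computation.\<close>

lemma ccomp_interchange:
  assumes \<chi>: "cell \<K> \<chi> (pconcat [L1, L2]) M p q"
    and \<psi>: "cell \<K> \<psi>1 K1 L1 h0 h1" "cell \<K> \<psi>2 K2 L2 h1 h2"
    and \<phi>: "cell \<K> \<phi>1 J1 K1 f0 f1" "cell \<K> \<phi>2 J2 K2 f1 f2"
  shows "ccomp \<K> \<chi> [ccomp \<K> \<psi>1 [\<phi>1], ccomp \<K> \<psi>2 [\<phi>2]]
    = ccomp \<K> (ccomp \<K> \<chi> [\<psi>1, \<psi>2]) [\<phi>1, \<phi>2]"
  using ccomp_assoc[of "[\<psi>1, \<psi>2]" "[[\<phi>1], [\<phi>2]]" \<chi>]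
    composable_single[OF \<psi>(1) \<phi>(1)] composable_single[OF \<psi>(2) \<phi>(2)]
    composable_pair[OF \<chi> \<psi>]
    composable_pair[OF \<chi> cell_ccomp_single[OF \<psi>(1) \<phi>(1)] cell_ccomp_single[OF \<psi>(2) \<phi>(2)]]
    composable_pair[OF cell_ccomp_pair[OF \<chi> \<psi>] \<phi>]
  by simp

section \<open>Unit laws\<close>

lemma cell_htgtE:
  assumes "cell \<K> \<phi> J K f g"
  obtains A B where "vert \<K> f A (fst K)" and "vert \<K> g B (vcod \<K> g)"
    and "hpath \<K> K (fst K) (vcod \<K> g)" and "plength K \<le> 1"
  using cell_boundary[OF assms] by (auto simp: hpath_def vert_def)

lemma ccomp_idv_left:
  assumes "cell \<K> \<psi> K L h k" and "cell \<K> \<phi> J K f g"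
  shows "ccomp \<K> \<psi> [idv \<K> f, \<phi>] = ccomp \<K> \<psi> [\<phi>]"
proof -
  obtain A where f: "vert \<K> f A (fst K)"
    using assms(2) by (rule cell_htgtE)
  have "composable \<K> \<psi> [idv \<K> f, \<phi>]"
    using assms(1) by (intro composable_pair[OF _ cell_idv[OF f] assms(2)])
      (simp add: pconcat_empty_left)
  then show ?thesis
    using ccomp_insert_idv[of f \<psi> "[]" "[\<phi>]"] composable_single[OF assms] f
    by (simp add: vert_def)
qed

lemma ccomp_idv_right:
  assumes "cell \<K> \<psi> K L h k" and "cell \<K> \<phi> J K f g"
  shows "ccomp \<K> \<psi> [\<phi>, idv \<K> g] = ccomp \<K> \<psi> [\<phi>]"
proof -
  obtain B where g: "vert \<K> g B (vcod \<K> g)"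
    using assms(2) by (rule cell_htgtE)
  have "composable \<K> \<psi> [\<phi>, idv \<K> g]"
    using assms(1) by (intro composable_pair[OF _ assms(2) cell_idv[OF g]]) simp
  then show ?thesis
    using ccomp_insert_idv[of g \<psi> "[\<phi>]" "[]"] composable_single[OF assms] g
    by (simp add: vert_def)
qed

lemma plength_le_1_cases:
  assumes "hpath \<K> L C D" and "plength L \<le> 1"
  obtains "L = (C, [])" and "D = C" and "C \<in> Obj \<K>"
  | J where "L = (C, [J])" and "horiz \<K> J C D"
  using assms by (cases L; cases "snd L") (auto simp: hpath_def horiz_def)

lemma cell_idp:
  assumes "hpath \<K> L C D" and "plength L \<le> 1"
  shows "cell \<K> (idp \<K> L) L L (vid \<K> C) (vid \<K> D)"
  using assms by (rule plength_le_1_cases) (auto intro: cell_idv cell_idh vert_vid)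

text \<open>Merges the unit axioms for \<open>idh\<close> and \<open>idv\<close>, so that later
  arguments need not distinguish the length of the horizontal target.\<close>

lemma idp_ccomp:
  assumes "cell \<K> \<phi> J L f g"
  shows "ccomp \<K> (idp \<K> L) [\<phi>] = \<phi>"
proof -
  have L: "hpath \<K> L (fst L) (vcod \<K> g)" "plength L \<le> 1"
    using cell_htgtE[OF assms] by blast+
  have comp: "composable \<K> (idp \<K> L) [\<phi>]"
    using composable_single[OF cell_idp[OF L] assms] .
  from L show ?thesis
  proof (cases rule: plength_le_1_cases)
    case 1
    then show ?thesis using comp idv_ccomp by (metis idp.simps(1))
  next
    case (2 K)
    then show ?thesis using comp idh_ccomp by (metis idp.simps(2) horiz_def)
  qed
qed

text \<open>The left unit law of horizontal composition,
  \<open>id\<^sub>f \<odot> \<phi> = \<phi>\<close>. Read backwards, this law and its mirror image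
  pad one cell to a pair.\<close>

lemma idp_ccomp_idv_left:
  assumes "cell \<K> \<phi> J L f g"
  shows "ccomp \<K> (idp \<K> L) [idv \<K> f, \<phi>] = \<phi>"
  using ccomp_idv_left[OF cell_idp assms] idp_ccomp[OF assms] cell_htgtE[OF assms] by metis

lemma idp_ccomp_idv_right:
  assumes "cell \<K> \<phi> J L f g"
  shows "ccomp \<K> (idp \<K> L) [\<phi>, idv \<K> g] = \<phi>"
  using ccomp_idv_right[OF cell_idp assms] idp_ccomp[OF assms] cell_htgtE[OF assms] by metis

lemma ccomp_idh_single:
  assumes "cell \<K> \<psi> (A, [J]) L h k" and "horiz \<K> J A B"
  shows "ccomp \<K> \<psi> [idh \<K> J] = \<psi>"
  using ccomp_idh[of "[J]" \<psi>] composable_single[OF assms(1) cell_idh[OF assms(2)]] assms(2)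
  by (simp add: horiz_def)

lemma ccomp_idv_vid:
  assumes "cell \<K> \<psi> (A, []) L h k"
  shows "ccomp \<K> \<psi> [idv \<K> (vid \<K> A)] = \<psi>"
proof -
  have "A \<in> Obj \<K>"
    using cell_boundary[OF assms] by (auto simp: hpath_def)
  with assms show ?thesis
    using ccomp_idv composable_single[OF assms cell_idv[OF vert_vid]] by blast
qed

end

section \<open>A factorisation of a vertical identity cell through \<open>J\<close>\<close>

locale vertical_factorisation = augmented_virtual_double_category \<K>
  for \<K> :: "('o, 'v, 'h, 'c) avdc" +
  fixes A C :: 'o and f :: 'v and J :: 'h and \<phi> \<psi> :: 'c
  assumes f: "vert \<K> f A C"
    and J: "horiz \<K> J A C"
    and \<phi>: "cell \<K> \<phi> (A, []) (A, [J]) (vid \<K> A) f"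
    and \<psi>: "cell \<K> \<psi> (A, [J]) (C, []) f (vid \<K> C)"
    and idv_f: "idv \<K> f = ccomp \<K> \<psi> [\<phi>]"
begin

lemma A: "A \<in> Obj \<K>" and C: "C \<in> Obj \<K>"
  using f vdom_Obj vcod_Obj by (auto simp: vert_def)

lemma idh_J: "cell \<K> (idh \<K> J) (A, [J]) (A, [J]) (vid \<K> A) (vid \<K> C)"
  using J by (rule cell_idh)

text \<open>Spells the source as the concatenated targets of \<phi> and \<psi>, the shape expected
  by the rules for pairs.\<close>

lemma idh_J': "cell \<K> (idh \<K> J) (pconcat [(A, [J]), (C, [])]) (A, [J]) (vid \<K> A) (vid \<K> C)"
  using idh_J by simp

lemma hcomp_eq: "hcomp \<K> \<phi> \<psi> = ccomp \<K> (idh \<K> J) [\<phi>, \<psi>]"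
  using \<phi> \<psi> by (simp add: hcomp_def cell_def)

lemma cell_hcomp: "cell \<K> (hcomp \<K> \<phi> \<psi>) (A, [J]) (A, [J]) (vid \<K> A) (vid \<K> C)"
  using cell_ccomp_pair[OF idh_J' \<phi> \<psi>] vcomp_vid_left[OF vert_vid] A C
  by (simp add: hcomp_eq pconcat_empty_left)

text \<open>Existence for the cartesian property: composing with \<psi> absorbs
  \<open>idh \<K> J\<close>, and \<open>\<psi> \<circ> \<phi> = id\<^sub>f\<close> turns the first
  cell of the pair into the identity cell of \<open>f \<circ> h\<close>.\<close>

lemma cartesian_factor:
  assumes "hpath \<K> H X Y" and "vert \<K> h X A"
    and "cell \<K> \<chi> H (C, []) (vcomp \<K> f h) k"
  shows "ccomp \<K> \<psi> [ccomp \<K> (idh \<K> J) [ccomp \<K> \<phi> [idv \<K> h], \<chi>]] = \<chi>" (is ?factor)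
    and "cell \<K> (ccomp \<K> (idh \<K> J) [ccomp \<K> \<phi> [idv \<K> h], \<chi>]) H (A, [J]) h k" (is ?cell)
proof -
  note \<chi> = assms(3)
  note h = cell_idv[OF assms(2)]
  have \<phi>h: "cell \<K> (ccomp \<K> \<phi> [idv \<K> h]) (X, []) (A, [J]) h (vcomp \<K> f h)"
    using cell_ccomp_single[OF \<phi> h] vcomp_vid_left[OF assms(2)] by simp
  have k: "\<exists>Y. vert \<K> k Y C"
    using cell_boundary[OF \<chi>] by (auto simp: hpath_def)
  show ?cell
    using cell_ccomp_pair[OF idh_J' \<phi>h \<chi>] vcomp_vid_left[OF assms(2)] k vcomp_vid_left assms(1)
    by (auto simp: pconcat_empty_left hpath_def)
  let ?iC = "idv \<K> (vid \<K> C)"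
  have iC: "cell \<K> ?iC (C, []) (C, []) (vid \<K> C) (vid \<K> C)"
    using C by (intro cell_idv vert_vid)
  have iC': "cell \<K> ?iC (pconcat [(C, []), (C, [])]) (C, []) (vid \<K> C) (vid \<K> C)"
    using iC by simp
  have "ccomp \<K> \<psi> [ccomp \<K> (idh \<K> J) [ccomp \<K> \<phi> [idv \<K> h], \<chi>]]
      = ccomp \<K> \<psi> [ccomp \<K> \<phi> [idv \<K> h], \<chi>]"
    using ccomp_assoc_single_pair[OF \<psi> idh_J' \<phi>h \<chi>] ccomp_idh_single[OF \<psi> J] by simp
  \<comment> \<open>Rewriting \<psi> as \<open>\<psi> \<odot> id\<^sub>C\<close> supplies a second
    inner cell to pair with \<chi>.\<close>
  also have "\<dots> = ccomp \<K> (ccomp \<K> ?iC [\<psi>, ?iC]) [ccomp \<K> \<phi> [idv \<K> h], \<chi>]"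
    using idp_ccomp_idv_right[OF \<psi>] by simp
  also have "\<dots> = ccomp \<K> ?iC [ccomp \<K> \<psi> [ccomp \<K> \<phi> [idv \<K> h]], ccomp \<K> ?iC [\<chi>]]"
    using ccomp_interchange[OF iC' \<psi> iC \<phi>h \<chi>] by simp
  also have "\<dots> = ccomp \<K> ?iC [idv \<K> (vcomp \<K> f h), \<chi>]"
    using ccomp_assoc_single[OF \<psi> \<phi> h] idv_f idv_vcomp[OF assms(2) f] idp_ccomp[OF \<chi>] by simp
  also have "\<dots> = \<chi>"
    using idp_ccomp_idv_left[OF \<chi>] by simp
  finally show ?factor .
qed

text \<open>Pad \<chi> to \<open>(id\<^sub>h, \<chi>)\<close> and interchange. The right side is the
  candidate factor of \<open>\<psi> \<circ> \<chi>\<close> through \<psi>, which is what uniqueness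
  requires.\<close>

lemma hcomp_ccomp:
  assumes "vert \<K> h X A" and "cell \<K> \<chi> H (A, [J]) h k"
  shows "ccomp \<K> (hcomp \<K> \<phi> \<psi>) [\<chi>]
    = ccomp \<K> (idh \<K> J) [ccomp \<K> \<phi> [idv \<K> h], ccomp \<K> \<psi> [\<chi>]]"
  using ccomp_interchange[OF idh_J' \<phi> \<psi> cell_idv[OF assms(1)] assms(2)]
    ccomp_idv_left[OF cell_hcomp assms(2)] by (simp add: hcomp_eq)

text \<open>Here the outer cell is padded, to \<open>\<chi> \<odot> id\<^sub>k\<close>, before
  interchanging. The right side is the candidate factor of \<open>\<chi> \<circ> \<phi>\<close>
  through \<phi>.\<close>

lemma ccomp_hcomp:
  assumes "cell \<K> \<chi> (A, [J]) L h k"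
  shows "ccomp \<K> \<chi> [hcomp \<K> \<phi> \<psi>]
    = ccomp \<K> (idp \<K> L) [ccomp \<K> \<chi> [\<phi>], ccomp \<K> (idv \<K> k) [\<psi>]]"
proof -
  obtain D where L: "hpath \<K> L (fst L) D" "plength L \<le> 1" and k: "vert \<K> k C D"
    using cell_boundary[OF assms] J by (auto simp: hpath_def horiz_def)
  have "cell \<K> (idp \<K> L) (pconcat [L, (D, [])]) L (vid \<K> (fst L)) (vid \<K> D)"
    using cell_idp[OF L] by simp
  from ccomp_interchange[OF this assms cell_idv[OF k] \<phi> \<psi>] show ?thesis
    using ccomp_assoc_single_pair[OF assms idh_J' \<phi> \<psi>] ccomp_idh_single[OF assms J]
      idp_ccomp_idv_right[OF assms] by (simp add: hcomp_eq)
qed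

text \<open>Existence for the weakly cocartesian property: padding \<phi> to
  \<open>(id\<^sub>A, \<phi>)\<close> sends \<open>id\<^sub>A\<close> to \<chi> and \<phi> to
  \<open>id\<^sub>k \<circ> \<psi>\<close>, whose composite is the identity cell of
  \<open>k \<circ> f\<close>.\<close>

lemma cocartesian_factor:
  assumes "vert \<K> g A B" and "vert \<K> k C D"
    and "cell \<K> \<chi> (A, []) L g (vcomp \<K> k f)"
  shows "ccomp \<K> (ccomp \<K> (idp \<K> L) [\<chi>, ccomp \<K> (idv \<K> k) [\<psi>]]) [\<phi>] = \<chi>" (is ?factor)
    and "cell \<K> (ccomp \<K> (idp \<K> L) [\<chi>, ccomp \<K> (idv \<K> k) [\<psi>]]) (A, [J]) L g k" (is ?cell)
proof -
  note \<chi> = assms(3)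
  have kf: "vert \<K> (vcomp \<K> k f) A D"
    using f assms(2) by (rule vert_vcomp)
  \<comment> \<open>The vertical boundaries of \<chi> fix the endpoints of \<open>L\<close>: the
    codomains of \<open>g\<close> and of \<open>k \<circ> f\<close>.\<close>
  have L: "hpath \<K> L B D" "plength L \<le> 1"
    using cell_boundary[OF \<chi>] kf assms(1) by (auto simp: hpath_def vert_def)
  note k = cell_idv[OF assms(2)]
  have k\<psi>: "cell \<K> (ccomp \<K> (idv \<K> k) [\<psi>]) (A, [J]) (D, []) (vcomp \<K> k f) k"
    using cell_ccomp_single[OF k \<psi>] vcomp_vid_right[OF assms(2)] by simp
  have L': "cell \<K> (idp \<K> L) (pconcat [L, (D, [])]) L (vid \<K> B) (vid \<K> D)"
    using cell_idp[OF L] by simp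
  show cell: ?cell
    using cell_ccomp_pair[OF L' \<chi> k\<psi>] vcomp_vid_left[OF assms(1)] vcomp_vid_left[OF assms(2)]
    by (simp add: pconcat_empty_left)
  have iA: "cell \<K> (idv \<K> (vid \<K> A)) (A, []) (A, []) (vid \<K> A) (vid \<K> A)"
    using A by (intro cell_idv vert_vid)
  have "ccomp \<K> (ccomp \<K> (idp \<K> L) [\<chi>, ccomp \<K> (idv \<K> k) [\<psi>]]) [\<phi>]
      = ccomp \<K> (ccomp \<K> (idp \<K> L) [\<chi>, ccomp \<K> (idv \<K> k) [\<psi>]]) [idv \<K> (vid \<K> A), \<phi>]"
    using ccomp_idv_left[OF cell \<phi>] by simp
  also have "\<dots> = ccomp \<K> (idp \<K> L)
      [ccomp \<K> \<chi> [idv \<K> (vid \<K> A)], ccomp \<K> (ccomp \<K> (idv \<K> k) [\<psi>]) [\<phi>]]"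
    using ccomp_interchange[OF L' \<chi> k\<psi> iA \<phi>] by simp
  also have "\<dots> = ccomp \<K> (idp \<K> L) [\<chi>, idv \<K> (vcomp \<K> k f)]"
    using ccomp_idv_vid[OF \<chi>] ccomp_assoc_single[OF k \<psi> \<phi>] idv_f idv_vcomp[OF f assms(2)] by simp
  also have "\<dots> = \<chi>"
    using \<chi> by (rule idp_ccomp_idv_right)
  finally show ?factor .
qed

text \<open>The case \<open>\<chi> = \<psi>\<close> of \<open>ccomp_hcomp\<close>, where the pair
  becomes \<open>(id\<^sub>f, \<psi>)\<close>.\<close>

lemma ccomp_hcomp_right: "ccomp \<K> \<psi> [hcomp \<K> \<phi> \<psi>] = \<psi>"
  using ccomp_hcomp[OF \<psi>] idv_f idp_ccomp[OF \<psi>] idp_ccomp_idv_left[OF \<psi>] by simp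

text \<open>The case \<open>\<chi> = \<phi>\<close> of \<open>hcomp_ccomp\<close>, where the pair
  becomes \<open>(\<phi>, id\<^sub>f)\<close>.\<close>

lemma hcomp_ccomp_left: "ccomp \<K> (hcomp \<K> \<phi> \<psi>) [\<phi>] = \<phi>"
  using hcomp_ccomp[OF vert_vid[OF A] \<phi>] ccomp_idv_vid[OF \<phi>] idv_f idp_ccomp_idv_right[OF \<phi>]
  by simp

section \<open>The four implications\<close>

lemma hcomp_eq_if_cartesian:
  assumes "cartesian \<K> \<psi>"
  shows "hcomp \<K> \<phi> \<psi> = idh \<K> J"
proof -
  have H: "hpath \<K> (A, [J]) A C"
    using J C by (simp add: hpath_def horiz_def)
  \<comment> \<open>Puts \<psi> in the form of a test cell for its own cartesian property, with
    \<open>h\<close> and \<open>k\<close> identities; both \<open>hcomp \<K> \<phi> \<psi>\<close>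
    and \<open>idh \<K> J\<close> are then factors.\<close>
  have \<psi>': "cell \<K> \<psi> (A, [J]) (C, []) (vcomp \<K> f (vid \<K> A)) (vcomp \<K> (vid \<K> C) (vid \<K> C))"
    using \<psi> vcomp_vid_right[OF f] vcomp_vid_left[OF vert_vid[OF C]] by simp
  have "\<exists>!\<theta>. cell \<K> \<theta> (A, [J]) (A, [J]) (vid \<K> A) (vid \<K> C) \<and> \<psi> = ccomp \<K> \<psi> [\<theta>]"
    using assms H \<psi>' \<psi> f vert_vid[OF A] vert_vid[OF C]
    by (simp add: cartesian_def cell_def vert_def)
  then show ?thesis
    using cell_hcomp ccomp_hcomp_right idh_J ccomp_idh_single[OF \<psi> J] by metis
qed

lemma hcomp_eq_if_weakly_cocartesian:
  assumes "weakly_cocartesian \<K> \<phi>"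
  shows "hcomp \<K> \<phi> \<psi> = idh \<K> J"
proof -
  have L: "hpath \<K> (A, [J]) A C"
    using J C by (simp add: hpath_def horiz_def)
  \<comment> \<open>Dually, \<phi> is tested against itself.\<close>
  have \<phi>': "cell \<K> \<phi> (A, []) (A, [J]) (vcomp \<K> (vid \<K> A) (vid \<K> A)) (vcomp \<K> (vid \<K> C) f)"
    using \<phi> vcomp_vid_left[OF f] vcomp_vid_left[OF vert_vid[OF A]] by simp
  have "\<exists>!\<theta>. cell \<K> \<theta> (A, [J]) (A, [J]) (vid \<K> A) (vid \<K> C) \<and> \<phi> = ccomp \<K> \<theta> [\<phi>]"
    using assms L \<phi>' \<phi> f vert_vid[OF A] vert_vid[OF C]
    by (simp add: weakly_cocartesian_def cell_def vert_def)
  then show ?thesis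
    using cell_hcomp hcomp_ccomp_left idh_J idp_ccomp[OF \<phi>] by (metis idp.simps(2))
qed

lemma cartesian_if_hcomp_eq:
  assumes "hcomp \<K> \<phi> \<psi> = idh \<K> J"
  shows "cartesian \<K> \<psi>"
proof -
  have bd: "\<psi> \<in> Cell \<K>" "hsrc \<K> \<psi> = (A, [J])" "htgt \<K> \<psi> = (C, [])" "vsrc \<K> \<psi> = f"
    "vtgt \<K> \<psi> = vid \<K> C" "vdom \<K> f = A" "vdom \<K> (vid \<K> C) = C"
    using \<psi> f vert_vid[OF C] by (auto simp: cell_def vert_def)
  have "\<exists>!\<theta>. cell \<K> \<theta> H (A, [J]) h k \<and> \<chi> = ccomp \<K> \<psi> [\<theta>]"
    if H: "hpath \<K> H X Y" and h: "vert \<K> h X A" and k: "vert \<K> k Y C"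
      and "cell \<K> \<chi> H (C, []) (vcomp \<K> f h) (vcomp \<K> (vid \<K> C) k)" for \<chi> H X Y h k
  proof -
    have \<chi>: "cell \<K> \<chi> H (C, []) (vcomp \<K> f h) k"
      using that(4) vcomp_vid_left[OF k] by simp
    \<comment> \<open>Uniqueness: \<open>\<theta> = id\<^sub>J \<circ> \<theta> = (\<phi> \<odot>
      \<psi>) \<circ> \<theta>\<close>, which depends on \<theta> only through
      \<open>\<psi> \<circ> \<theta> = \<chi>\<close>.\<close>
    have "\<theta> = ccomp \<K> (idh \<K> J) [ccomp \<K> \<phi> [idv \<K> h], \<chi>]"
      if "cell \<K> \<theta> H (A, [J]) h k" "\<chi> = ccomp \<K> \<psi> [\<theta>]" for \<theta>
      using hcomp_ccomp[OF h that(1)] idp_ccomp[OF that(1)] assms that(2) by simp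
    then show ?thesis
      using cartesian_factor[OF H h \<chi>] by metis
  qed
  then show ?thesis
    by (simp add: cartesian_def bd)
qed

lemma weakly_cocartesian_if_hcomp_eq:
  assumes "hcomp \<K> \<phi> \<psi> = idh \<K> J"
  shows "weakly_cocartesian \<K> \<phi>"
proof -
  have bd: "\<phi> \<in> Cell \<K>" "hsrc \<K> \<phi> = (A, [])" "htgt \<K> \<phi> = (A, [J])" "vsrc \<K> \<phi> = vid \<K> A"
    "vtgt \<K> \<phi> = f" "vcod \<K> f = C" "vcod \<K> (vid \<K> A) = A"
    using \<phi> f vert_vid[OF A] by (auto simp: cell_def vert_def)
  have "\<exists>!\<theta>. cell \<K> \<theta> (A, [J]) L g k \<and> \<chi> = ccomp \<K> \<theta> [\<phi>]"
    if g: "vert \<K> g A B" and k: "vert \<K> k C D"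
      and "cell \<K> \<chi> (A, []) L (vcomp \<K> g (vid \<K> A)) (vcomp \<K> k f)" for \<chi> L B D g k
  proof -
    have \<chi>: "cell \<K> \<chi> (A, []) L g (vcomp \<K> k f)"
      using that(3) vcomp_vid_right[OF g] by simp
    \<comment> \<open>Uniqueness: \<open>\<theta> = \<theta> \<circ> id\<^sub>J = \<theta> \<circ>
      (\<phi> \<odot> \<psi>)\<close>, which depends on \<theta> only through
      \<open>\<theta> \<circ> \<phi> = \<chi>\<close>.\<close>
    have "\<theta> = ccomp \<K> (idp \<K> L) [\<chi>, ccomp \<K> (idv \<K> k) [\<psi>]]"
      if "cell \<K> \<theta> (A, [J]) L g k" "\<chi> = ccomp \<K> \<theta> [\<phi>]" for \<theta>
      using ccomp_hcomp[OF that(1)] ccomp_idh_single[OF that(1) J] assms that(2) by simp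
    then show ?thesis
      using cocartesian_factor[OF g k \<chi>] by metis
  qed
  then show ?thesis
    by (simp add: weakly_cocartesian_def bd)
qed

end

theorem lemma5p4:
  fixes \<K> :: "('o, 'v, 'h, 'c) avdc"
    and A C :: 'o and f :: 'v and J :: 'h and \<phi> \<psi> :: 'c
  assumes "augmented_virtual_double_category \<K>"
    and "vert \<K> f A C"
    and "horiz \<K> J A C"
    and "cell \<K> \<phi> (A, []) (A, [J]) (vid \<K> A) f"
    and "cell \<K> \<psi> (A, [J]) (C, []) f (vid \<K> C)"
    and "idv \<K> f = ccomp \<K> \<psi> [\<phi>]"
  shows "(cartesian \<K> \<psi> \<longleftrightarrow> hcomp \<K> \<phi> \<psi> = idh \<K> J) \<and>
         (hcomp \<K> \<phi> \<psi> = idh \<K> J \<longleftrightarrow> weakly_cocartesian \<K> \<phi>)"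
proof -
  interpret vertical_factorisation \<K> A C f J \<phi> \<psi>
    using assms by (intro vertical_factorisation.intro vertical_factorisation_axioms.intro)
  show ?thesis
    using hcomp_eq_if_cartesian hcomp_eq_if_weakly_cocartesian
      cartesian_if_hcomp_eq weakly_cocartesian_if_hcomp_eq by blast
qed

end
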